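(* Let $P\colon\mathcal{E}\to\mathcal{B}$ and $P'\colon\mathcal{E}'\to\mathcal{B}'$ be functors between small categories, and let $F_1\colon\mathcal{E}\to\mathcal{E}'$, $G_1\colon\mathcal{E}'\to\mathcal{E}$, $F_2\colon\mathcal{B}\to\mathcal{B}'$, $G_2\colon\mathcal{B}'\to\mathcal{B}$ be functors, together with natural transformations $$\lambda\colon P'F_1\Rightarrow F_2P,\qquad \mu\colon PG_1\Rightarrow G_2P',\qquad \alpha\colon G_2F_2\Rightarrow1_{\mathcal{B}},\qquad \beta\colon F_2G_2\Rightarrow1_{\mathcal{B}'}.$$ Then $\mathrm{dsecat}(P)=\mathrm{dsecat}(P')$.
   Context: All categories are small. A cover of a category $\mathcal{B}$ is a family of (not necessarily full) subcategories such that every morphism of $\mathcal{B}$ belongs to at least one of them. For a functor $P\colon\mathcal{E}\to\mathcal{B}$, the directed sectional category $\mathrm{dsecat}(P)$ is the least integer $n\geq0$ for which $\mathcal{B}$ admits a cover $\{\mathcal{U}_0,\dots,\mathcal{U}_n\}$ and, for every $i$, a functor $s_i\colon\mathcal{U}_i\to\mathcal{E}$ together with a natural transformation $P s_i\Rightarrow\iota_i$, where $\iota_i\colon\mathcal{U}_i\hookrightarrow\mathcal{B}$ is the inclusion; it is $\infty$ if no such finite cover exists. *)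

theory Defs
  imports Main "HOL-Library.Extended_Nat"
begin

text \<open>
  Small categories and functors are given on explicit carriers; only the values of the operations
  on the carriers (and, for composition, on composable pairs) are meaningful.
  Composition is written in the usual order: \<open>Comp C g f\<close> is ``g after f''.
\<close>

record ('o, 'm) precategory =
  Obj :: "'o set"
  Mor :: "'m set"
  Dom :: "'m \<Rightarrow> 'o"
  Cod :: "'m \<Rightarrow> 'o"
  Ident :: "'o \<Rightarrow> 'm"
  Comp :: "'m \<Rightarrow> 'm \<Rightarrow> 'm"

locale category =
  fixes C :: "('o, 'm) precategory"
  assumes Dom_in: "f \<in> Mor C \<Longrightarrow> Dom C f \<in> Obj C"
    and Cod_in: "f \<in> Mor C \<Longrightarrow> Cod C f \<in> Obj C"
    and Ident_in: "x \<in> Obj C \<Longrightarrow> Ident C x \<in> Mor C"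
    and Dom_Ident: "x \<in> Obj C \<Longrightarrow> Dom C (Ident C x) = x"
    and Cod_Ident: "x \<in> Obj C \<Longrightarrow> Cod C (Ident C x) = x"
    and Comp_in: "\<lbrakk>f \<in> Mor C; g \<in> Mor C; Dom C g = Cod C f\<rbrakk> \<Longrightarrow> Comp C g f \<in> Mor C"
    and Dom_Comp: "\<lbrakk>f \<in> Mor C; g \<in> Mor C; Dom C g = Cod C f\<rbrakk> \<Longrightarrow> Dom C (Comp C g f) = Dom C f"
    and Cod_Comp: "\<lbrakk>f \<in> Mor C; g \<in> Mor C; Dom C g = Cod C f\<rbrakk> \<Longrightarrow> Cod C (Comp C g f) = Cod C g"
    and Comp_Ident_right: "f \<in> Mor C \<Longrightarrow> Comp C f (Ident C (Dom C f)) = f"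
    and Comp_Ident_left: "f \<in> Mor C \<Longrightarrow> Comp C (Ident C (Cod C f)) f = f"
    and Comp_assoc:
      "\<lbrakk>f \<in> Mor C; g \<in> Mor C; h \<in> Mor C; Dom C g = Cod C f; Dom C h = Cod C g\<rbrakk>
        \<Longrightarrow> Comp C h (Comp C g f) = Comp C (Comp C h g) f"

record ('o, 'm, 'p, 'n) prefunctor =
  Omap :: "'o \<Rightarrow> 'p"
  Mmap :: "'m \<Rightarrow> 'n"

locale cat_functor = source: category A + target: category B
  for A :: "('o, 'm) precategory" and B :: "('p, 'n) precategory" +
  fixes F :: "('o, 'm, 'p, 'n) prefunctor"
  assumes Omap_in: "x \<in> Obj A \<Longrightarrow> Omap F x \<in> Obj B"
    and Mmap_in: "f \<in> Mor A \<Longrightarrow> Mmap F f \<in> Mor B"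
    and Dom_Mmap: "f \<in> Mor A \<Longrightarrow> Dom B (Mmap F f) = Omap F (Dom A f)"
    and Cod_Mmap: "f \<in> Mor A \<Longrightarrow> Cod B (Mmap F f) = Omap F (Cod A f)"
    and Mmap_Ident: "x \<in> Obj A \<Longrightarrow> Mmap F (Ident A x) = Ident B (Omap F x)"
    and Mmap_Comp: "\<lbrakk>f \<in> Mor A; g \<in> Mor A; Dom A g = Cod A f\<rbrakk>
        \<Longrightarrow> Mmap F (Comp A g f) = Comp B (Mmap F g) (Mmap F f)"

text \<open>
  The underlying maps of the identity functor of a category are also those of the inclusion
  of any of its subcategories; which functor is meant is determined by the source category.
\<close>

definition id_functor :: "('o, 'm, 'o, 'm) prefunctor" where
  "id_functor = \<lparr>Omap = (\<lambda>x. x), Mmap = (\<lambda>f. f)\<rparr>"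

definition comp_functor ::
  "('p, 'n, 'q, 'k) prefunctor \<Rightarrow> ('o, 'm, 'p, 'n) prefunctor \<Rightarrow> ('o, 'm, 'q, 'k) prefunctor"
  (infixr \<open>\<circ>\<^sub>F\<close> 55) where
  "G \<circ>\<^sub>F F = \<lparr>Omap = (\<lambda>x. Omap G (Omap F x)), Mmap = (\<lambda>f. Mmap G (Mmap F f))\<rparr>"

locale nat_trans = F: cat_functor A B F + G: cat_functor A B G
  for A :: "('o, 'm) precategory" and B :: "('p, 'n) precategory"
    and F G :: "('o, 'm, 'p, 'n) prefunctor" +
  fixes \<tau> :: "'o \<Rightarrow> 'n"
  assumes component_in: "x \<in> Obj A \<Longrightarrow> \<tau> x \<in> Mor B"
    and Dom_component: "x \<in> Obj A \<Longrightarrow> Dom B (\<tau> x) = Omap F x"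
    and Cod_component: "x \<in> Obj A \<Longrightarrow> Cod B (\<tau> x) = Omap G x"
    and naturality: "f \<in> Mor A
        \<Longrightarrow> Comp B (\<tau> (Cod A f)) (Mmap F f) = Comp B (Mmap G f) (\<tau> (Dom A f))"

locale subcategory = sub: category U + ambient: category B
  for U B :: "('o, 'm) precategory" +
  assumes Obj_subset: "Obj U \<subseteq> Obj B"
    and Mor_subset: "Mor U \<subseteq> Mor B"
    and Dom_eq: "f \<in> Mor U \<Longrightarrow> Dom U f = Dom B f"
    and Cod_eq: "f \<in> Mor U \<Longrightarrow> Cod U f = Cod B f"
    and Ident_eq: "x \<in> Obj U \<Longrightarrow> Ident U x = Ident B x"
    and Comp_eq: "\<lbrakk>f \<in> Mor U; g \<in> Mor U; Dom U g = Cod U f\<rbrakk> \<Longrightarrow> Comp U g f = Comp B g f"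

definition is_cover ::
  "('o, 'm) precategory \<Rightarrow> 'i set \<Rightarrow> ('i \<Rightarrow> ('o, 'm) precategory) \<Rightarrow> bool" where
  "is_cover B I U \<longleftrightarrow> (\<forall>i\<in>I. subcategory (U i) B) \<and> (\<forall>f\<in>Mor B. \<exists>i\<in>I. f \<in> Mor (U i))"

definition has_sectional_cover ::
  "('a, 'b) precategory \<Rightarrow> ('o, 'm) precategory \<Rightarrow> ('a, 'b, 'o, 'm) prefunctor \<Rightarrow> nat \<Rightarrow> bool" where
  "has_sectional_cover E B P n \<longleftrightarrow>
    (\<exists>U. is_cover B {0..n} U \<and>
      (\<forall>i\<in>{0..n}. \<exists>s \<tau>. cat_functor (U i) E s \<and> nat_trans (U i) B (P \<circ>\<^sub>F s) id_functor \<tau>))"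

definition dsecat ::
  "('a, 'b) precategory \<Rightarrow> ('o, 'm) precategory \<Rightarrow> ('a, 'b, 'o, 'm) prefunctor \<Rightarrow> enat" where
  "dsecat E B P =
    (if \<exists>n. has_sectional_cover E B P n then enat (LEAST n. has_sectional_cover E B P n) else \<infinity>)"

end

theory Submission
  imports Defs
begin

text \<open>
  A sectional cover \<open>(U\<^sub>i, s\<^sub>i, \<tau>\<^sub>i)\<close> of \<open>P\<close> is pulled back along \<open>G\<^sub>2\<close>: on the
  subcategory of \<open>B'\<close> of all morphisms that \<open>G\<^sub>2\<close> maps into \<open>U\<^sub>i\<close>, the functor
  \<open>F\<^sub>1 s\<^sub>i G\<^sub>2\<close> is a section of \<open>P'\<close> up to the composite
  \<open>P' F\<^sub>1 s\<^sub>i G\<^sub>2 \<Rightarrow> F\<^sub>2 P s\<^sub>i G\<^sub>2 \<Rightarrow> F\<^sub>2 G\<^sub>2 \<Rightarrow> 1\<close> of whiskerings of \<open>\<lambda>\<close>,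
  \<open>\<tau>\<^sub>i\<close> and \<open>\<beta>\<close>. The hypotheses are symmetric in \<open>P\<close> and \<open>P'\<close>, so both
  inequalities follow.
\<close>

lemma comp_functor_assoc: "(H \<circ>\<^sub>F G) \<circ>\<^sub>F F = H \<circ>\<^sub>F (G \<circ>\<^sub>F F)"
  by (simp add: comp_functor_def)

lemma comp_functor_id_left [simp]:
  fixes F :: "('o, 'm, 'p, 'n) prefunctor"
  shows "id_functor \<circ>\<^sub>F F = F"
  by (simp add: comp_functor_def id_functor_def)

text \<open>Since \<open>id_functor\<close> also serves as the inclusion of a subcategory, this says
  as well that restricting a functor to a subcategory leaves its record unchanged.\<close>

lemma comp_functor_id_right [simp]:
  fixes F :: "('o, 'm, 'p, 'n) prefunctor"
  shows "F \<circ>\<^sub>F id_functor = F"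
  by (simp add: comp_functor_def id_functor_def)

lemma cat_functor_comp:
  assumes "cat_functor A B F" and "cat_functor B C G"
  shows "cat_functor A C (G \<circ>\<^sub>F F)"
proof -
  interpret F: cat_functor A B F by fact
  interpret G: cat_functor B C G by fact
  show ?thesis
    by unfold_locales
      (simp_all add: comp_functor_def F.Omap_in F.Mmap_in F.Dom_Mmap F.Cod_Mmap F.Mmap_Ident
        F.Mmap_Comp G.Omap_in G.Mmap_in G.Dom_Mmap G.Cod_Mmap G.Mmap_Ident G.Mmap_Comp)
qed

text \<open>The naturality square at \<open>f\<close> is the square of \<open>\<tau>\<close> at
  \<open>Mmap H f\<close>.\<close>

lemma nat_trans_whisker_right:
  assumes "nat_trans A B F G \<tau>" and "cat_functor X A H"
  shows "nat_trans X B (F \<circ>\<^sub>F H) (G \<circ>\<^sub>F H) (\<lambda>x. \<tau> (Omap H x))"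
proof -
  interpret \<tau>: nat_trans A B F G \<tau> by fact
  interpret H: cat_functor X A H by fact
  interpret FH: cat_functor X B "F \<circ>\<^sub>F H"
    using H.cat_functor_axioms \<tau>.F.cat_functor_axioms by (rule cat_functor_comp)
  interpret GH: cat_functor X B "G \<circ>\<^sub>F H"
    using H.cat_functor_axioms \<tau>.G.cat_functor_axioms by (rule cat_functor_comp)
  show ?thesis
  proof unfold_locales
    fix f assume "f \<in> Mor X"
    then show "Comp B (\<tau> (Omap H (Cod X f))) (Mmap (F \<circ>\<^sub>F H) f) =
        Comp B (Mmap (G \<circ>\<^sub>F H) f) (\<tau> (Omap H (Dom X f)))"
      using \<tau>.naturality[of "Mmap H f"]
      by (simp add: comp_functor_def H.Mmap_in H.Dom_Mmap H.Cod_Mmap)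
  qed (simp_all add: comp_functor_def H.Omap_in \<tau>.component_in \<tau>.Dom_component \<tau>.Cod_component)
qed

text \<open>Applying \<open>K\<close> to a naturality square of \<open>\<tau>\<close> gives a
  commuting square, because \<open>K\<close> preserves composites.\<close>

lemma nat_trans_whisker_left:
  assumes "nat_trans A B F G \<tau>" and "cat_functor B C K"
  shows "nat_trans A C (K \<circ>\<^sub>F F) (K \<circ>\<^sub>F G) (\<lambda>x. Mmap K (\<tau> x))"
proof -
  interpret \<tau>: nat_trans A B F G \<tau> by fact
  interpret K: cat_functor B C K by fact
  interpret KF: cat_functor A C "K \<circ>\<^sub>F F"
    using \<tau>.F.cat_functor_axioms K.cat_functor_axioms by (rule cat_functor_comp)
  interpret KG: cat_functor A C "K \<circ>\<^sub>F G"
    using \<tau>.G.cat_functor_axioms K.cat_functor_axioms by (rule cat_functor_comp)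
  show ?thesis
  proof unfold_locales
    fix f assume f: "f \<in> Mor A"
    then have "Comp C (Mmap K (\<tau> (Cod A f))) (Mmap K (Mmap F f)) =
        Mmap K (Comp B (\<tau> (Cod A f)) (Mmap F f))"
      by (simp add: K.Mmap_Comp \<tau>.component_in \<tau>.Dom_component \<tau>.F.Mmap_in \<tau>.F.Cod_Mmap
          \<tau>.F.source.Cod_in)
    also have "\<dots> = Mmap K (Comp B (Mmap G f) (\<tau> (Dom A f)))"
      using f by (simp add: \<tau>.naturality)
    also have "\<dots> = Comp C (Mmap K (Mmap G f)) (Mmap K (\<tau> (Dom A f)))"
      using f by (simp add: K.Mmap_Comp \<tau>.component_in \<tau>.Cod_component \<tau>.G.Mmap_in
          \<tau>.G.Dom_Mmap \<tau>.F.source.Dom_in)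
    finally show "Comp C (Mmap K (\<tau> (Cod A f))) (Mmap (K \<circ>\<^sub>F F) f) =
        Comp C (Mmap (K \<circ>\<^sub>F G) f) (Mmap K (\<tau> (Dom A f)))"
      by (simp add: comp_functor_def)
  qed (simp_all add: comp_functor_def K.Mmap_in K.Dom_Mmap K.Cod_Mmap \<tau>.component_in
      \<tau>.Dom_component \<tau>.Cod_component)
qed

text \<open>The naturality squares of \<open>\<sigma>\<close> and \<open>\<tau>\<close> are pasted
  along their common edge \<open>Mmap G f\<close>.\<close>

lemma nat_trans_vertical_comp:
  assumes "nat_trans A B F G \<sigma>" and "nat_trans A B G H \<tau>"
  shows "nat_trans A B F H (\<lambda>x. Comp B (\<tau> x) (\<sigma> x))"
proof -
  interpret \<sigma>: nat_trans A B F G \<sigma> by fact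
  interpret \<tau>: nat_trans A B G H \<tau> by fact
  note target = \<sigma>.F.target.Comp_in \<sigma>.F.target.Dom_Comp \<sigma>.F.target.Cod_Comp
  note components = \<sigma>.component_in \<sigma>.Dom_component \<sigma>.Cod_component
    \<tau>.component_in \<tau>.Dom_component \<tau>.Cod_component
  show ?thesis
  proof unfold_locales
    fix f assume f: "f \<in> Mor A"
    let ?x = "Dom A f" and ?y = "Cod A f"
    have xy: "?x \<in> Obj A" "?y \<in> Obj A"
      using f by (simp_all add: \<sigma>.F.source.Dom_in \<sigma>.F.source.Cod_in)
    note facts = f xy components \<sigma>.F.Mmap_in \<sigma>.F.Dom_Mmap \<sigma>.F.Cod_Mmap
      \<sigma>.G.Mmap_in \<sigma>.G.Dom_Mmap \<sigma>.G.Cod_Mmap \<tau>.G.Mmap_in \<tau>.G.Dom_Mmap \<tau>.G.Cod_Mmap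
    have "Comp B (Comp B (\<tau> ?y) (\<sigma> ?y)) (Mmap F f) = Comp B (\<tau> ?y) (Comp B (\<sigma> ?y) (Mmap F f))"
      by (rule \<sigma>.F.target.Comp_assoc[symmetric]) (simp_all add: facts)
    also have "\<dots> = Comp B (\<tau> ?y) (Comp B (Mmap G f) (\<sigma> ?x))"
      using f by (simp add: \<sigma>.naturality)
    also have "\<dots> = Comp B (Comp B (\<tau> ?y) (Mmap G f)) (\<sigma> ?x)"
      by (rule \<sigma>.F.target.Comp_assoc) (simp_all add: facts)
    also have "\<dots> = Comp B (Comp B (Mmap H f) (\<tau> ?x)) (\<sigma> ?x)"
      using f by (simp add: \<tau>.naturality)
    also have "\<dots> = Comp B (Mmap H f) (Comp B (\<tau> ?x) (\<sigma> ?x))"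
      by (rule \<sigma>.F.target.Comp_assoc[symmetric]) (simp_all add: facts)
    finally show "Comp B (Comp B (\<tau> ?y) (\<sigma> ?y)) (Mmap F f) =
        Comp B (Mmap H f) (Comp B (\<tau> ?x) (\<sigma> ?x))" .
  qed (simp_all add: target components)
qed

lemma cat_functor_inclusion:
  assumes "subcategory U B"
  shows "cat_functor U B id_functor"
proof -
  interpret subcategory U B by fact
  show ?thesis
    by unfold_locales
      (use Obj_subset Mor_subset in
        \<open>auto simp: id_functor_def Dom_eq Cod_eq Ident_eq Comp_eq\<close>)
qed

text \<open>For a subcategory \<open>U\<close> of the target of \<open>G\<close>, this is the strict
  pullback of \<open>U\<close> along \<open>G\<close>. The record update shrinks only the carriers,
  so the operations agree with those of \<open>A\<close> by construction.\<close>

definition preimage_category ::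
  "('o, 'm) precategory \<Rightarrow> ('o, 'm, 'p, 'n) prefunctor \<Rightarrow> ('p, 'n) precategory \<Rightarrow>
    ('o, 'm) precategory" where
  "preimage_category A G U =
    A\<lparr>Obj := {x \<in> Obj A. Omap G x \<in> Obj U}, Mor := {f \<in> Mor A. Mmap G f \<in> Mor U}\<rparr>"

text \<open>\<open>G\<close> preserves the operations and those of \<open>U\<close> agree with those
  of \<open>B\<close>, so the image under \<open>G\<close> of a domain, codomain, identity or
  composite can be computed inside \<open>U\<close>, which is closed under them. The same equations
  make \<open>G\<close> a functor into \<open>U\<close>.\<close>

lemma preimage_category:
  assumes "cat_functor A B G" and "subcategory U B"
  shows subcategory_preimage: "subcategory (preimage_category A G U) A"
    and cat_functor_preimage: "cat_functor (preimage_category A G U) U G"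
proof -
  interpret G: cat_functor A B G by fact
  interpret U: subcategory U B by fact
  have dom: "Omap G (Dom A f) = Dom U (Mmap G f)" and cod: "Omap G (Cod A f) = Cod U (Mmap G f)"
    if "f \<in> Mor A" "Mmap G f \<in> Mor U" for f
    using that by (simp_all add: U.Dom_eq U.Cod_eq G.Dom_Mmap G.Cod_Mmap)
  have ident: "Mmap G (Ident A x) = Ident U (Omap G x)" if "x \<in> Obj A" "Omap G x \<in> Obj U" for x
    using that by (simp add: U.Ident_eq G.Mmap_Ident)
  have comp: "Mmap G (Comp A g f) = Comp U (Mmap G g) (Mmap G f)"
      "Dom U (Mmap G g) = Cod U (Mmap G f)"
    if "f \<in> Mor A" "g \<in> Mor A" "Mmap G f \<in> Mor U" "Mmap G g \<in> Mor U" "Dom A g = Cod A f" for f g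
    \<comment> \<open>Read from right to left, \<open>dom\<close> and \<open>cod\<close> reduce
      composability in \<open>U\<close> to composability in \<open>A\<close>.\<close>
    using that by (simp_all add: U.Comp_eq G.Mmap_Comp flip: dom cod)
  have cat: "category (preimage_category A G U)"
    by unfold_locales
      (auto simp: preimage_category_def dom cod ident comp
        U.sub.Dom_in U.sub.Cod_in U.sub.Ident_in U.sub.Comp_in
        G.source.Dom_in G.source.Cod_in G.source.Ident_in G.source.Dom_Ident G.source.Cod_Ident
        G.source.Comp_in G.source.Dom_Comp G.source.Cod_Comp G.source.Comp_Ident_left
        G.source.Comp_Ident_right G.source.Comp_assoc)
  show "subcategory (preimage_category A G U) A"
    by (intro subcategory.intro cat G.source.category_axioms subcategory_axioms.intro)
      (auto simp: preimage_category_def)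
  show "cat_functor (preimage_category A G U) U G"
    by (intro cat_functor.intro cat U.sub.category_axioms cat_functor_axioms.intro)
      (auto simp: preimage_category_def dom cod ident comp)
qed

text \<open>This is one inequality, stated for a fixed \<open>n\<close> and one direction of the
  data so that it can be applied again with the roles of \<open>P\<close> and \<open>P'\<close>
  exchanged. Pulling back keeps the index set of the cover.\<close>

lemma has_sectional_cover_transfer:
  assumes F1: "cat_functor E E' F1" and F2: "cat_functor B B' F2" and G2: "cat_functor B' B G2"
    and lam: "nat_trans E B' (P' \<circ>\<^sub>F F1) (F2 \<circ>\<^sub>F P) lam"
    and \<beta>: "nat_trans B' B' (F2 \<circ>\<^sub>F G2) id_functor \<beta>"
    and cover: "has_sectional_cover E B P n"
  shows "has_sectional_cover E' B' P' n"
proof -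
  obtain U where U: "is_cover B {0..n} U"
    and sections: "\<forall>i\<in>{0..n}. \<exists>s \<tau>. cat_functor (U i) E s \<and>
      nat_trans (U i) B (P \<circ>\<^sub>F s) id_functor \<tau>"
    using cover by (auto simp: has_sectional_cover_def)
  interpret G2: cat_functor B' B G2 by fact
  define V where "V i = preimage_category B' G2 (U i)" for i
  have U_sub: "subcategory (U i) B" if "i \<in> {0..n}" for i
    using U that by (simp add: is_cover_def)
  have V_sub: "subcategory (V i) B'" and G2_V: "cat_functor (V i) (U i) G2" if "i \<in> {0..n}" for i
    unfolding V_def using preimage_category[OF G2 U_sub[OF that]] by simp_all
  have "\<exists>i\<in>{0..n}. f \<in> Mor (V i)" if f: "f \<in> Mor B'" for f
  proof -
    obtain i where "i \<in> {0..n}" "Mmap G2 f \<in> Mor (U i)"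
      using U G2.Mmap_in[OF f] by (auto simp only: is_cover_def)
    then show ?thesis
      using f by (auto simp: V_def preimage_category_def)
  qed
  with V_sub have V: "is_cover B' {0..n} V"
    by (simp add: is_cover_def)
  have "\<exists>s \<tau>. cat_functor (V i) E' s \<and> nat_trans (V i) B' (P' \<circ>\<^sub>F s) id_functor \<tau>"
    if i: "i \<in> {0..n}" for i
  proof -
    obtain s \<tau> where s: "cat_functor (U i) E s"
      and \<tau>: "nat_trans (U i) B (P \<circ>\<^sub>F s) id_functor \<tau>"
      using sections i by blast
    have sG2: "cat_functor (V i) E (s \<circ>\<^sub>F G2)"
      using G2_V[OF i] s by (rule cat_functor_comp)
    \<comment> \<open>Three transformations are to be composed; only their existence matters, so
      their components stay unnamed. The first is \<open>lam\<close> restricted along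
      \<open>s \<circ>\<^sub>F G2\<close>.\<close>
    obtain \<sigma>1 where "nat_trans (V i) B' (P' \<circ>\<^sub>F F1 \<circ>\<^sub>F s \<circ>\<^sub>F G2) (F2 \<circ>\<^sub>F P \<circ>\<^sub>F s \<circ>\<^sub>F G2) \<sigma>1"
      using nat_trans_whisker_right[OF lam sG2] by (auto simp: comp_functor_assoc)
    \<comment> \<open>Here \<open>\<tau>\<close> is whiskered with \<open>G2\<close>, corestricted
      to \<open>U i\<close>, and then with \<open>F2\<close>; the inclusion of \<open>U i\<close>
      disappears from the target by simplification.\<close>
    moreover obtain \<sigma>2 where "nat_trans (V i) B' (F2 \<circ>\<^sub>F P \<circ>\<^sub>F s \<circ>\<^sub>F G2) (F2 \<circ>\<^sub>F G2) \<sigma>2"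
      using nat_trans_whisker_left[OF nat_trans_whisker_right[OF \<tau> G2_V[OF i]] F2]
      by (auto simp: comp_functor_assoc)
    \<comment> \<open>Restricting \<open>\<beta>\<close> to \<open>V i\<close> is whiskering it with
      the inclusion into \<open>B'\<close>.\<close>
    moreover obtain \<sigma>3 where "nat_trans (V i) B' (F2 \<circ>\<^sub>F G2) id_functor \<sigma>3"
      using nat_trans_whisker_right[OF \<beta> cat_functor_inclusion[OF V_sub[OF i]]] by auto
    ultimately obtain \<sigma> where "nat_trans (V i) B' (P' \<circ>\<^sub>F F1 \<circ>\<^sub>F s \<circ>\<^sub>F G2) id_functor \<sigma>"
      by (blast intro: nat_trans_vertical_comp)
    with cat_functor_comp[OF sG2 F1] show ?thesis
      by blast
  qed
  with V show ?thesis
    by (auto simp only: has_sectional_cover_def)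
qed

theorem theorem6p7:
  fixes E :: "('eo, 'em) precategory" and B :: "('bo, 'bm) precategory"
    and E' :: "('eo', 'em') precategory" and B' :: "('bo', 'bm') precategory"
    and P :: "('eo, 'em, 'bo, 'bm) prefunctor" and P' :: "('eo', 'em', 'bo', 'bm') prefunctor"
    and F1 :: "('eo, 'em, 'eo', 'em') prefunctor" and G1 :: "('eo', 'em', 'eo, 'em) prefunctor"
    and F2 :: "('bo, 'bm, 'bo', 'bm') prefunctor" and G2 :: "('bo', 'bm', 'bo, 'bm) prefunctor"
    and lam :: "'eo \<Rightarrow> 'bm'" and mu :: "'eo' \<Rightarrow> 'bm"
    and \<alpha> :: "'bo \<Rightarrow> 'bm" and \<beta> :: "'bo' \<Rightarrow> 'bm'"
  assumes "category E" and "category B" and "category E'" and "category B'"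
    and "cat_functor E B P" and "cat_functor E' B' P'"
    and "cat_functor E E' F1" and "cat_functor E' E G1"
    and "cat_functor B B' F2" and "cat_functor B' B G2"
    and "nat_trans E B' (P' \<circ>\<^sub>F F1) (F2 \<circ>\<^sub>F P) lam"
    and "nat_trans E' B (P \<circ>\<^sub>F G1) (G2 \<circ>\<^sub>F P') mu"
    and "nat_trans B B (G2 \<circ>\<^sub>F F2) id_functor \<alpha>"
    and "nat_trans B' B' (F2 \<circ>\<^sub>F G2) id_functor \<beta>"
  shows "dsecat E B P = dsecat E' B' P'"
proof -
  have "has_sectional_cover E B P = has_sectional_cover E' B' P'"
    \<comment> \<open>The first instance uses \<open>F1\<close>, \<open>lam\<close> and
      \<open>\<beta>\<close>, the second \<open>G1\<close>, \<open>mu\<close> and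
      \<open>\<alpha>\<close> with \<open>F2\<close> and \<open>G2\<close> exchanged. Equality of
      the predicates settles the infinite case too.\<close>
    using has_sectional_cover_transfer[OF assms(7,9,10,11,14)]
      has_sectional_cover_transfer[OF assms(8,10,9,12,13)]
    by (intro ext) blast
  then show ?thesis
    by (simp add: dsecat_def)
qed

end
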